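(* Let $m,n$ be integers with $n\ge 2$ and $m-n\geq 3$, such that one of $m$ and $n$ is even and the other is odd. Then the metric dimension of the generalized Möbius ladder $M_{m,n}$ is $3$, i.e. $\dim(M_{m,n})=3$.
   Context: Generalized Möbius ladder: let $P_m$ and $P_n$ be the paths on vertices $u_1,\ldots,u_m$ and $v_1,\ldots,v_n$ respectively (consecutive vertices adjacent), and let $P_m\times P_n$ be their Cartesian product. The graph $M_{m,n}$ is obtained from $P_m\times P_n$ by a $180^\circ$ twist and identification of the two ends: for each $1\le j\le n$ the vertex $(u_1,v_j)$ is identified with the vertex $(u_m,v_{n+1-j})$, and for each $1\le j\le n-1$ the edge joining $(u_1,v_j)$ and $(u_1,v_{j+1})$ is identified with the edge joining $(u_m,v_{n+1-j})$ and $(u_m,v_{n-j})$. Equivalently, writing $v_{i,j}$ for $(u_i,v_j)$, $M_{m,n}$ is the simple graph with vertex set $\{v_{i,j} : 1\le i\le m-1,\ 1\le j\le n\}$ and edges: $v_{i,j}v_{i,j+1}$ for $1\le i\le m-1$, $1\le j\le n-1$; $v_{i,j}v_{i+1,j}$ for $1\le i\le m-2$, $1\le j\le n$; and $v_{m-1,j}v_{1,n+1-j}$ for $1\le j\le n$. Metric dimension: for a connected graph $G$, $d(u,v)$ denotes the length (number of edges) of a shortest path between $u$ and $v$. For an ordered set $W=\{w_1,\ldots,w_k\}$ of vertices of $G$, the representation of a vertex $v$ with respect to $W$ is the $k$-tuple $(d(v,w_1),\ldots,d(v,w_k))$. $W$ is a resolving set for $G$ if distinct vertices of $G$ have distinct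 representations with respect to $W$. The metric dimension $\dim(G)$ is the minimum cardinality of a resolving set of $G$. *)

theory Defs
  imports "Graph_Theory.Graph_Theory"
begin

text \<open>
  As usual in \<open>Graph_Theory\<close>, an undirected graph is a symmetric digraph: every edge is present as
  two opposite arcs.
\<close>

text \<open>
  The vertex \<open>v\<^sub>i\<^sub>,\<^sub>j\<close> is the pair \<open>(i, j)\<close>. The third family of edges closes the strip with the
  \<open>180\<close> degree twist: the column \<open>i = m\<close> has been identified with the reversed column \<open>i = 1\<close>.
\<close>

definition mobius_ladder_edges :: "nat \<Rightarrow> nat \<Rightarrow> (nat \<times> nat) rel" where
  "mobius_ladder_edges m n =
     {((i, j), (i, j + 1)) | i j. 1 \<le> i \<and> i \<le> m - 1 \<and> 1 \<le> j \<and> j \<le> n - 1} \<union>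
     {((i, j), (i + 1, j)) | i j. 1 \<le> i \<and> i \<le> m - 2 \<and> 1 \<le> j \<and> j \<le> n} \<union>
     {((m - 1, j), (1, n + 1 - j)) | j. 1 \<le> j \<and> j \<le> n}"

definition mobius_ladder :: "nat \<Rightarrow> nat \<Rightarrow> (nat \<times> nat) pair_pre_digraph" where
  "mobius_ladder m n =
     \<lparr> pverts = {1..m - 1} \<times> {1..n},
       parcs = mobius_ladder_edges m n \<union> (mobius_ladder_edges m n)\<inverse> \<rparr>"

text \<open>Meaningful only if some path leads from \<open>u\<close> to \<open>v\<close>; all graphs of interest are connected.\<close>

definition graph_dist :: "('a, 'b) pre_digraph \<Rightarrow> 'a \<Rightarrow> 'a \<Rightarrow> nat" where
  "graph_dist G u v = (LEAST k. \<exists>p. pre_digraph.apath G u p v \<and> length p = k)"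

text \<open>An ordered set of vertices is a list of vertices without repetitions.\<close>

definition representation :: "('a, 'b) pre_digraph \<Rightarrow> 'a list \<Rightarrow> 'a \<Rightarrow> nat list" where
  "representation G ws v = map (graph_dist G v) ws"

definition resolving_set :: "('a, 'b) pre_digraph \<Rightarrow> 'a list \<Rightarrow> bool" where
  "resolving_set G ws \<longleftrightarrow>
     distinct ws \<and> set ws \<subseteq> verts G \<and>
     (\<forall>u\<in>verts G. \<forall>v\<in>verts G. u \<noteq> v \<longrightarrow> representation G ws u \<noteq> representation G ws v)"

definition metric_dim :: "('a, 'b) pre_digraph \<Rightarrow> nat" where
  "metric_dim G = (LEAST k. \<exists>ws. resolving_set G ws \<and> length ws = k)"

text \<open>
  On connected graphs, \<open>graph_dist\<close> is the library's shortest path distance \<open>\<mu>\<close> for unit weights.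
\<close>

lemma (in fin_digraph) mu_unit_eq_graph_dist:
  assumes "u \<rightarrow>\<^sup>* v"
  shows "\<mu> (\<lambda>_. 1) u v = ereal (real (graph_dist G u v))"
proof -
  have cost: "awalk_cost (\<lambda>_. 1) p = real (length p)" for p :: "'b awalk"
    by (induction p) auto
  have ex: "\<exists>k p. apath u p v \<and> length p = k"
    using assms by (auto simp: reachable_apath)
  have "\<exists>p. apath u p v \<and> length p = graph_dist G u v"
    unfolding graph_dist_def by (rule LeastI_ex[OF ex])
  then obtain p where p: "apath u p v" "length p = graph_dist G u v" by blast
  have "\<exists>q. apath u q v \<and> \<mu> (\<lambda>_. 1) u v = awalk_cost (\<lambda>_. 1) q"
    using assms by (intro min_cost_awalk) simp_all
  then obtain q where q: "apath u q v" "\<mu> (\<lambda>_. 1) u v = awalk_cost (\<lambda>_. 1) q" by blast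
  have "graph_dist G u v \<le> length q"
    unfolding graph_dist_def by (rule Least_le) (use q in blast)
  moreover have "\<mu> (\<lambda>_. 1) u v \<le> awalk_cost (\<lambda>_. 1) p"
    using p by (intro min_cost_le_walk_cost) (simp add: apath_def)
  ultimately show ?thesis
    using p q by (simp add: cost)
qed

lemma pair_graph_mobius_ladder:
  assumes "m \<ge> 3"
  shows "pair_graph (mobius_ladder m n)"
proof -
  let ?M = "mobius_ladder m n"
  have wf: "parcs ?M \<subseteq> pverts ?M \<times> pverts ?M"
    using assms by (auto simp: mobius_ladder_def mobius_ladder_edges_def)
  have loop: "fst e \<noteq> snd e" if "e \<in> parcs ?M" for e
    using that assms by (auto simp: mobius_ladder_def mobius_ladder_edges_def)
  have fin: "finite (pverts ?M)" by (simp add: mobius_ladder_def)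
  have sym: "symmetric ?M"
    by (auto simp: symmetric_def mobius_ladder_def intro!: symI)
  show ?thesis
    by unfold_locales
      (use wf loop fin sym finite_subset[OF wf] in \<open>auto simp: mem_Times_iff subset_iff\<close>)
qed

lemma connected_mobius_ladder:
  assumes "m \<ge> 3" "n \<ge> 1"
  shows "connected (mobius_ladder m n)"
proof -
  let ?M = "mobius_ladder m n"
  interpret pair_graph ?M by (rule pair_graph_mobius_ladder) fact
  have vert: "pverts ?M = {1..m - 1} \<times> {1..n}" by (simp add: mobius_ladder_def)
  have up: "(i, 1) \<rightarrow>\<^sup>*\<^bsub>?M\<^esub> (i, Suc j)" if "i \<in> {1..m - 1}" "j < n" for i j
    using that(2)
  proof (induction j)
    case 0
    then show ?case using that assms by (auto simp: vert)
  next
    case (Suc j)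
    then have "((i, Suc j), (i, Suc (Suc j))) \<in> parcs ?M"
      using that by (auto simp: mobius_ladder_def mobius_ladder_edges_def)
    with Suc show ?case by (auto intro: reachable_adj_trans)
  qed
  have right: "(1, 1) \<rightarrow>\<^sup>*\<^bsub>?M\<^esub> (Suc i, 1)" if "i < m - 1" for i
    using that
  proof (induction i)
    case 0
    then show ?case using assms by (auto simp: vert)
  next
    case (Suc i)
    then have "((Suc i, 1), (Suc (Suc i), 1)) \<in> parcs ?M"
      using assms by (auto simp: mobius_ladder_def mobius_ladder_edges_def)
    with Suc show ?case by (auto intro: reachable_adj_trans)
  qed
  have all: "(1, 1) \<rightarrow>\<^sup>*\<^bsub>?M\<^esub> v" if "v \<in> pverts ?M" for v
  proof -
    define i j where "i = fst v - 1" and "j = snd v - 1"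
    then have v: "v = (Suc i, Suc j)" "i < m - 1" "j < n"
      using that by (auto simp: vert)
    show ?thesis using right[of i] up[of "Suc i" j] v by (auto intro: reachable_trans)
  qed
  have "u \<rightarrow>\<^sup>*\<^bsub>?M\<^esub> v" if "u \<in> pverts ?M" "v \<in> pverts ?M" for u v
    using all[OF that(1)] all[OF that(2)] symmetric_reachable[OF sym_arcs]
    by (blast intro: reachable_trans)
  moreover have "pverts ?M \<noteq> {}" using assms by (auto simp: vert)
  ultimately show ?thesis
    by (auto simp: connected_def strongly_connected_def reachable_mk_symmetric_eq[OF sym_arcs])
qed

end

theory Submission
  imports Defs
begin

text \<open>
  The ladder is the strip \<open>\<int> \<times> {1..n}\<close> modulo the glide reflection
  \<open>(x, y) \<mapsto> (x + m - 1, n + 1 - y)\<close>, so its distance is a minimum of two \<open>\<ell>\<^sub>1\<close> distances.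
  From the distances to the corners \<open>(1, 1)\<close> and \<open>(1, n)\<close> one reads off \<open>i + j\<close> and \<open>i - j\<close>, each
  up to a reflection; outside the first column, the distance to \<open>(2, 1)\<close> excludes
  the reflection of \<open>i + j\<close>, and then that of \<open>i - j\<close> is excluded by the parity of \<open>m + n\<close>.

  Two vertices \<open>w\<close> and \<open>v\<close> never resolve, because two neighbours of one of them are equidistant from
  the other. If \<open>w\<close> has degree four, this is the pigeonhole principle: distances to \<open>v\<close> vary by at
  most one along an edge. If both lie on the boundary, such neighbours of \<open>w\<close> can be written down.
\<close>

section \<open>Graph distance from a potential function\<close>

text \<open>The Lipschitz condition makes \<open>D\<close> a lower bound for the length of every
  walk to \<open>w\<close>, and following descending arcs produces a path that attains it. Descent
  also forces \<open>w\<close> to be the only zero of \<open>D\<close>.\<close>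

lemma (in wf_digraph) graph_dist_eqI:
  fixes D :: "'a \<Rightarrow> nat"
  assumes u: "u \<in> verts G" and w: "w \<in> verts G"
    and zero: "D w = 0"
    and lipschitz: "\<And>e. e \<in> arcs G \<Longrightarrow> D (tail G e) \<le> D (head G e) + 1"
    and descent: "\<And>v. v \<in> verts G \<Longrightarrow> v \<noteq> w \<Longrightarrow>
      \<exists>e\<in>arcs G. tail G e = v \<and> D v = D (head G e) + 1"
  shows "graph_dist G u w = D u"
  unfolding graph_dist_def
proof (rule Least_equality)
  \<comment> \<open>The bound on \<open>D\<close> along the path is carried through the induction
    because \<open>apath\<close> forbids repetitions: a vertex put in front has a strictly larger
    value than all later ones.\<close>
  have "\<exists>p. apath v p w \<and> length p = D v \<and> (\<forall>x\<in>set (awalk_verts v p). D x \<le> D v)"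
    if "v \<in> verts G" "D v = k" for v k
    using that
  proof (induction k arbitrary: v)
    case 0
    then have "v = w" using descent[of v] by fastforce
    then show ?case using w by (intro exI[of _ "[]"]) (simp add: apath_Nil_iff zero)
  next
    case (Suc k)
    then have "v \<noteq> w" using zero by auto
    then obtain e where e: "e \<in> arcs G" "tail G e = v" "D v = D (head G e) + 1"
      using descent Suc by blast
    then obtain p where p: "apath (head G e) p w" "length p = D (head G e)"
      "\<forall>x\<in>set (awalk_verts (head G e) p). D x \<le> D (head G e)"
      using Suc.IH[of "head G e"] Suc.prems by auto
    then have "apath v (e # p) w" using e by (fastforce simp: apath_Cons_iff)
    then show ?case using e p by (intro exI[of _ "e # p"]) auto
  qed
  then show "\<exists>p. apath u p w \<and> length p = D u" using u by blast
next
  have "D v \<le> length p" if "awalk v p w" for v p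
    using that
  proof (induction p arbitrary: v)
    case Nil
    then show ?case by (simp add: awalk_Nil_iff zero)
  next
    case (Cons e p)
    then show ?case using lipschitz[of e] by (fastforce simp: awalk_Cons_iff)
  qed
  then show "\<And>k. \<exists>p. apath u p w \<and> length p = k \<Longrightarrow> D u \<le> k"
    by (auto simp: apath_def)
qed

text \<open>
  The \<open>\<ell>\<^sub>1\<close> distances from \<open>u\<close> to the two lifts of \<open>v\<close> that can be nearest when \<open>n < m\<close>.
\<close>

definition direct_dist :: "nat \<times> nat \<Rightarrow> nat \<times> nat \<Rightarrow> int" where
  "direct_dist u v = \<bar>int (fst u) - int (fst v)\<bar> + \<bar>int (snd u) - int (snd v)\<bar>"

text \<open>Going once around the strip in either direction lifts \<open>(a, b)\<close> to
  \<open>(a + m - 1, n + 1 - b)\<close> and \<open>(a - m + 1, n + 1 - b)\<close>. The nearer of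
  these two lies at horizontal distance \<open>m - 1 - \<bar>i - a\<bar>\<close> from
  \<open>(i, j)\<close>.\<close>

definition through_dist :: "nat \<Rightarrow> nat \<Rightarrow> nat \<times> nat \<Rightarrow> nat \<times> nat \<Rightarrow> int" where
  "through_dist m n u v = int m - 1 - \<bar>int (fst u) - int (fst v)\<bar>
     + \<bar>int (snd u) + int (snd v) - int n - 1\<bar>"

definition twisted_dist :: "nat \<Rightarrow> nat \<Rightarrow> nat \<times> nat \<Rightarrow> nat \<times> nat \<Rightarrow> nat" where
  "twisted_dist m n u v = nat (min (direct_dist u v) (through_dist m n u v))"

lemma direct_dist_pair: "direct_dist (i, j) (a, b) = \<bar>int i - int a\<bar> + \<bar>int j - int b\<bar>"
  by (simp add: direct_dist_def)

lemma through_dist_pair: "through_dist m n (i, j) (a, b) =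
    int m - 1 - \<bar>int i - int a\<bar> + \<bar>int j + int b - int n - 1\<bar>"
  by (simp add: through_dist_def)

lemmas dist_pair = direct_dist_pair through_dist_pair

text \<open>The bounds on the columns make \<open>through_dist\<close> nonnegative, so
  \<open>nat\<close> truncates nothing.\<close>

lemma twisted_dist_int:
  assumes "i < m" "a < m"
  shows "int (twisted_dist m n (i, j) (a, b)) =
    min (direct_dist (i, j) (a, b)) (through_dist m n (i, j) (a, b))"
  using assms by (simp add: twisted_dist_def dist_pair)

lemma twisted_dist_self: "twisted_dist m n v v = 0"
  by (simp add: twisted_dist_def direct_dist_def)

lemma twisted_dist_cong:
  assumes "direct_dist u w = direct_dist v w \<and> through_dist m n u w = through_dist m n v w \<or>
    direct_dist u w = through_dist m n v w \<and> through_dist m n u w = direct_dist v w"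
  shows "twisted_dist m n u w = twisted_dist m n v w"
  using assms by (auto simp: twisted_dist_def min.commute)

section \<open>Vertices and arcs of the ladder\<close>

lemma pverts_mobius_ladder [simp]: "pverts (mobius_ladder m n) = {1..m - 1} \<times> {1..n}"
  by (simp add: mobius_ladder_def)

lemma mobius_vertexE:
  assumes "v \<in> pverts (mobius_ladder m n)"
  obtains i j where "v = (i, j)" "1 \<le> i" "i < m" "1 \<le> j" "j \<le> n"
  using assms by (cases v) auto

lemma mobius_arc_sym:
  "(u, v) \<in> parcs (mobius_ladder m n) \<Longrightarrow> (v, u) \<in> parcs (mobius_ladder m n)"
  by (auto simp: mobius_ladder_def)

lemma mobius_arc_vertical:
  assumes "1 \<le> i" "i < m" "1 \<le> j" "j < n"
  shows "((i, j), (i, j + 1)) \<in> parcs (mobius_ladder m n)"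
  using assms by (auto simp: mobius_ladder_def mobius_ladder_edges_def)

lemma mobius_arc_horizontal:
  assumes "1 \<le> i" "i + 1 < m" "1 \<le> j" "j \<le> n"
  shows "((i, j), (i + 1, j)) \<in> parcs (mobius_ladder m n)"
  using assms by (auto simp: mobius_ladder_def mobius_ladder_edges_def)

lemma mobius_arc_twist:
  assumes "1 \<le> j" "j \<le> n"
  shows "((m - 1, j), (1, n + 1 - j)) \<in> parcs (mobius_ladder m n)"
  using assms by (auto simp: mobius_ladder_def mobius_ladder_edges_def)

text \<open>Unordered pairs absorb the orientation of the arc, which leaves one case for each family
  of edges.\<close>

lemma mobius_arc_cases:
  assumes "(u, v) \<in> parcs (mobius_ladder m n)"
  obtains (vertical) i j where "1 \<le> i" "i < m" "1 \<le> j" "j < n" "{u, v} = {(i, j), (i, j + 1)}"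
  | (horizontal) i j where "1 \<le> i" "i + 1 < m" "1 \<le> j" "j \<le> n" "{u, v} = {(i, j), (i + 1, j)}"
  | (twist) j where "1 \<le> j" "j \<le> n" "{u, v} = {(m - 1, j), (1, n + 1 - j)}"
proof -
  have edge: thesis
    if "(x, y) \<in> mobius_ladder_edges m n" "{x, y} = {u, v}" for x y
  proof -
    from that(1) consider
        i j where "x = (i, j)" "y = (i, j + 1)" "1 \<le> i" "i \<le> m - 1" "1 \<le> j" "j \<le> n - 1"
      | i j where "x = (i, j)" "y = (i + 1, j)" "1 \<le> i" "i \<le> m - 2" "1 \<le> j" "j \<le> n"
      | j where "x = (m - 1, j)" "y = (1, n + 1 - j)" "1 \<le> j" "j \<le> n"
      unfolding mobius_ladder_edges_def by auto
    then show thesis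
    proof cases
      case (1 i j)
      show ?thesis by (rule vertical[of i j]) (use 1 that(2) in auto)
    next
      case (2 i j)
      show ?thesis by (rule horizontal[of i j]) (use 2 that(2) in auto)
    next
      case (3 j)
      show ?thesis by (rule twist[of j]) (use 3 that(2) in auto)
    qed
  qed
  have "(u, v) \<in> mobius_ladder_edges m n \<or> (v, u) \<in> mobius_ladder_edges m n"
    using assms by (simp add: mobius_ladder_def)
  then show thesis using edge by blast
qed

section \<open>The distance formula\<close>

text \<open>On vertical and horizontal edges each of the two distances changes by at most one. On a
  twist edge they exchange roles: the direct distance at one end is within one of the through
  distance at the other. The minimum does not see the exchange.\<close>

lemma twisted_dist_arc:
  assumes "m \<ge> 3" "n < m" "(u, v) \<in> parcs (mobius_ladder m n)" "w \<in> pverts (mobius_ladder m n)"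
  shows "twisted_dist m n u w \<le> twisted_dist m n v w + 1"
proof -
  obtain a b where w: "w = (a, b)" "1 \<le> a" "a < m" "1 \<le> b" "b \<le> n"
    using assms(4) by (rule mobius_vertexE)
  have min_diff: "\<bar>min p q - min p' q'\<bar> \<le> 1"
    if "\<bar>p - p'\<bar> \<le> 1 \<and> \<bar>q - q'\<bar> \<le> 1 \<or> \<bar>p - q'\<bar> \<le> 1 \<and> \<bar>q - p'\<bar> \<le> 1" for p q p' q' :: int
    using that by linarith
  have sym: "twisted_dist m n u w \<le> twisted_dist m n v w + 1"
    if "{u, v} = {x, y}" "\<bar>int (twisted_dist m n x w) - int (twisted_dist m n y w)\<bar> \<le> 1" for x y
    using that by (auto simp: doubleton_eq_iff)
  show ?thesis
    using assms(3)
  proof (cases rule: mobius_arc_cases)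
    case (vertical i j)
    have "\<bar>direct_dist (i, j) w - direct_dist (i, j + 1) w\<bar> \<le> 1"
      "\<bar>through_dist m n (i, j) w - through_dist m n (i, j + 1) w\<bar> \<le> 1"
      unfolding w(1) dist_pair by simp_all
    then have "\<bar>int (twisted_dist m n (i, j) w) - int (twisted_dist m n (i, j + 1) w)\<bar> \<le> 1"
      unfolding w(1) using vertical w by (simp only: twisted_dist_int min_diff simp_thms)
    then show ?thesis using sym vertical by blast
  next
    case (horizontal i j)
    have "\<bar>direct_dist (i, j) w - direct_dist (i + 1, j) w\<bar> \<le> 1"
      "\<bar>through_dist m n (i, j) w - through_dist m n (i + 1, j) w\<bar> \<le> 1"
      unfolding w(1) dist_pair by simp_all
    then have "\<bar>int (twisted_dist m n (i, j) w) - int (twisted_dist m n (i + 1, j) w)\<bar> \<le> 1"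
      unfolding w(1) using horizontal w add_lessD1[of i 1 m]
      by (simp only: twisted_dist_int min_diff simp_thms)
    then show ?thesis using sym horizontal by blast
  next
    case (twist j)
    have "\<bar>direct_dist (m - 1, j) w - through_dist m n (1, n + 1 - j) w\<bar> \<le> 1"
      "\<bar>through_dist m n (m - 1, j) w - direct_dist (1, n + 1 - j) w\<bar> \<le> 1"
      using twist w assms(1) unfolding w(1) dist_pair by (simp_all add: of_nat_diff)
    moreover have "m - 1 < m" "1 < m" using assms(1) by simp_all
    ultimately have
      "\<bar>int (twisted_dist m n (m - 1, j) w) - int (twisted_dist m n (1, n + 1 - j) w)\<bar> \<le> 1"
      unfolding w(1) using w by (simp only: twisted_dist_int min_diff simp_thms)
    then show ?thesis using sym twist by blast
  qed
qed

text \<open>The step from \<open>v\<close> goes towards the lift of \<open>w\<close> that attains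
  the minimum: vertically while the rows differ, then horizontally.\<close>

lemma twisted_dist_descent:
  assumes "m \<ge> 3" "n < m" "v \<in> pverts (mobius_ladder m n)" "w \<in> pverts (mobius_ladder m n)" "v \<noteq> w"
  shows "\<exists>x. (v, x) \<in> parcs (mobius_ladder m n) \<and> twisted_dist m n v w = twisted_dist m n x w + 1"
proof -
  obtain i j where v: "v = (i, j)" "1 \<le> i" "i < m" "1 \<le> j" "j \<le> n"
    using assms(3) by (rule mobius_vertexE)
  obtain a b where w: "w = (a, b)" "1 \<le> a" "a < m" "1 \<le> b" "b \<le> n"
    using assms(4) by (rule mobius_vertexE)
  let ?p = "direct_dist (i, j) (a, b)" and ?q = "through_dist m n (i, j) (a, b)"
  have step: ?thesis
    if "((i, j), (i', j')) \<in> parcs (mobius_ladder m n)" "i' < m"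
      "min ?p ?q = min (direct_dist (i', j') (a, b)) (through_dist m n (i', j') (a, b)) + 1"
    for i' j'
  proof -
    have "int (twisted_dist m n v w) = int (twisted_dist m n (i', j') w) + 1"
      using that v w by (simp only: twisted_dist_int)
    then show ?thesis using that(1) v(1) by (metis of_nat_1 of_nat_add of_nat_eq_iff)
  qed
  \<comment> \<open>In each pattern the smaller distance drops by one and the other by at most one.
    In \<open>min_twist\<close> the step crosses the twist, so the two distances also change
    places.\<close>
  have min_direct: "min p q = min p' q' + 1" if "p \<le> q" "p' = p - 1" "q' \<ge> q - 1" for p q p' q' :: int
    using that by linarith
  have min_through: "min p q = min p' q' + 1" if "q < p" "q' = q - 1" "p' \<ge> p - 1" for p q p' q' :: int
    using that by linarith
  have min_twist: "min p q = min p' q' + 1" if "q < p" "p' = q - 1" "q' \<ge> p - 1" for p q p' q' :: int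
    using that by linarith
  have up: "((i, j), (i, j + 1)) \<in> parcs (mobius_ladder m n)" if "j < n"
    using that v mobius_arc_vertical[of i m j n] by blast
  have down: "((i, j), (i, j - 1)) \<in> parcs (mobius_ladder m n)" if "1 < j"
    using that v mobius_arc_sym[OF mobius_arc_vertical[of i m "j - 1" n]] by force
  have right: "((i, j), (i + 1, j)) \<in> parcs (mobius_ladder m n)" if "i + 1 < m"
    using that v mobius_arc_horizontal[of i m j n] by blast
  have left: "((i, j), (i - 1, j)) \<in> parcs (mobius_ladder m n)" if "1 < i"
    using that v mobius_arc_sym[OF mobius_arc_horizontal[of "i - 1" m j n]] by force
  show ?thesis
  proof (cases "?p \<le> ?q")
    case True
    consider "j < b" | "b < j" | "j = b" "i < a" | "j = b" "a < i"
      using assms(5) v w by force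
    then show ?thesis
    proof cases
      case 1
      show ?thesis
        by (rule step[OF up _ min_direct]) (use 1 v w True in \<open>simp_all add: dist_pair\<close>)
    next
      case 2
      show ?thesis
        by (rule step[OF down _ min_direct])
          (use 2 v w True in \<open>simp_all add: dist_pair of_nat_diff\<close>)
    next
      case 3
      show ?thesis
        by (rule step[OF right _ min_direct]) (use 3 v w True in \<open>simp_all add: dist_pair\<close>)
    next
      case 4
      show ?thesis
        by (rule step[OF left _ min_direct])
          (use 4 v w True in \<open>simp_all add: dist_pair of_nat_diff\<close>)
    qed
  next
    case False
    \<comment> \<open>Within one column the direct distance is at most \<open>n - 1\<close>, while
      the through distance is at least \<open>m - 1\<close>; here \<open>n < m\<close> is what makes
      the direct one smaller.\<close>
    have "i \<noteq> a"
    proof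
      assume "i = a"
      then show False using False assms(2) v w by (simp add: dist_pair)
    qed
    \<comment> \<open>The target row is now \<open>n + 1 - b\<close>, and horizontal moves lead away
      from column \<open>a\<close>, since the route passes over the end of the strip. At the first
      or last column the move is the twist edge itself.\<close>
    then consider "j + b < n + 1" | "n + 1 < j + b"
      | "j + b = n + 1" "a < i" "i < m - 1" | "j + b = n + 1" "a < i" "i = m - 1"
      | "j + b = n + 1" "i < a" "1 < i" | "j + b = n + 1" "i < a" "i = 1"
      using v w by linarith
    then show ?thesis
    proof cases
      case 1
      show ?thesis
        by (rule step[OF up _ min_through]) (use 1 v w False in \<open>simp_all add: dist_pair\<close>)
    next
      case 2
      show ?thesis
        by (rule step[OF down _ min_through])
          (use 2 v w False in \<open>simp_all add: dist_pair of_nat_diff\<close>)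
    next
      case 3
      show ?thesis
        by (rule step[OF right _ min_through]) (use 3 v w False in \<open>simp_all add: dist_pair\<close>)
    next
      case 4
      have "((i, j), (1, n + 1 - j)) \<in> parcs (mobius_ladder m n)"
        using 4 v mobius_arc_twist[of j n m] by blast
      then show ?thesis
        by (rule step[OF _ _ min_twist])
          (use 4 v w False assms(1) in \<open>simp_all add: dist_pair of_nat_diff\<close>)
    next
      case 5
      show ?thesis
        by (rule step[OF left _ min_through])
          (use 5 v w False in \<open>simp_all add: dist_pair of_nat_diff\<close>)
    next
      case 6
      have "((i, j), (m - 1, n + 1 - j)) \<in> parcs (mobius_ladder m n)"
        using 6 v mobius_arc_sym[OF mobius_arc_twist[of "n + 1 - j" n m]] by force
      then show ?thesis
        by (rule step[OF _ _ min_twist])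
          (use 6 v w False assms(1) in \<open>simp_all add: dist_pair of_nat_diff\<close>)
    qed
  qed
qed

lemma graph_dist_mobius_ladder:
  assumes "m \<ge> 3" "n < m" "v \<in> pverts (mobius_ladder m n)" "w \<in> pverts (mobius_ladder m n)"
  shows "graph_dist (with_proj (mobius_ladder m n)) v w = twisted_dist m n v w"
proof -
  interpret pair_graph "mobius_ladder m n" by (rule pair_graph_mobius_ladder) fact
  show ?thesis
  proof (rule graph_dist_eqI[where D = "\<lambda>x. twisted_dist m n x w"])
    show "twisted_dist m n (fst e) w \<le> twisted_dist m n (snd e) w + 1"
      if "e \<in> parcs (mobius_ladder m n)" for e
      using twisted_dist_arc[of m n "fst e" "snd e" w] assms that by simp
    show "\<exists>e\<in>parcs (mobius_ladder m n). fst e = x \<and>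
        twisted_dist m n x w = twisted_dist m n (snd e) w + 1"
      if "x \<in> pverts (mobius_ladder m n)" "x \<noteq> w" for x
      using twisted_dist_descent[of m n x w] assms that by fastforce
  qed (use assms in \<open>simp_all add: twisted_dist_self\<close>)
qed

section \<open>Three resolving vertices\<close>

lemma twisted_dist_corners_inj:
  assumes "n \<ge> 2" "m \<ge> n + 3" "odd (m + n)"
    and "u \<in> pverts (mobius_ladder m n)" "v \<in> pverts (mobius_ladder m n)"
    and "twisted_dist m n u (1, 1) = twisted_dist m n v (1, 1)"
    and "twisted_dist m n u (1, n) = twisted_dist m n v (1, n)"
    and "twisted_dist m n u (2, 1) = twisted_dist m n v (2, 1)"
  shows "u = v"
proof -
  have corner1: "int (twisted_dist m n (i, j) (1, 1)) =
      min (int i + int j - 2) (int m + int n - (int i + int j))"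
    and cornern: "int (twisted_dist m n (i, j) (1, n)) =
      min (int i - int j + int n - 1) (int m - 1 - (int i - int j))"
    and third: "2 \<le> i \<Longrightarrow> int (twisted_dist m n (i, j) (2, 1)) =
      min (int i + int j - 3) (int m + int n + 1 - (int i + int j))"
    \<comment> \<open>The first column lies on the other side of \<open>(2, 1)\<close>, so the
      formula for \<open>2 \<le> i\<close> fails there; this is why it needs separate treatment
      below.\<close>
    and third_first_column: "i = 1 \<Longrightarrow> int (twisted_dist m n (i, j) (2, 1)) = int j"
    if "1 \<le> i" "i < m" "1 \<le> j" "j \<le> n" for i j
    using that assms(1,2) by (simp_all add: twisted_dist_int dist_pair algebra_simps)
  \<comment> \<open>The arguments of the minimum have slopes \<open>1\<close> and \<open>-1\<close>
    in \<open>x\<close>, so equal minima leave only equality or reflection in the crossing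
    point.\<close>
  have fold: "x = y \<or> x + y = c - d" if "min (x + d) (c - x) = min (y + d) (c - y)" for x y c d :: int
    using that by (auto simp: min_def split: if_splits)
  obtain t where t: "int m + int n = 2 * t + 1"
    using assms(3) by (metis oddE of_nat_add even_of_nat)
  have same_sheet: "i = a \<and> j = b"
    if "int i + int j = int a + int b" "int i - int j = int a - int b \<or>
      int i - int j + (int a - int b) = int m - int n" for i j a b
  proof -
    \<comment> \<open>With equal sums the left side is \<open>2 * (i - b)\<close>, which is even,
      whereas \<open>m - n\<close> is odd.\<close>
    have "int i - int j + (int a - int b) \<noteq> int m - int n"
    proof
      assume "int i - int j + (int a - int b) = int m - int n"
      then have "2 * (int i - int b + int n - t) = 1"
        using that(1) t by (simp add: algebra_simps)
      then show False by presburger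
    qed
    then have "int i = int a" using that by linarith
    with that(1) show ?thesis by simp
  qed
  have first_column: "a = 1 \<and> j = b"
    if ab: "1 \<le> a" "a < m" "1 \<le> b" "b \<le> n" and j: "1 \<le> j" "j \<le> n"
      and eq: "twisted_dist m n (1, j) (1, 1) = twisted_dist m n (a, b) (1, 1)"
        "twisted_dist m n (1, j) (1, n) = twisted_dist m n (a, b) (1, n)"
        "twisted_dist m n (1, j) (2, 1) = twisted_dist m n (a, b) (2, 1)"
    for j a b
  proof (cases "a = 1")
    case True
    then show ?thesis using third_first_column[of 1 j] third_first_column[of a b] ab j eq by simp
  next
    case False
    have "1 < m" using ab by simp
    have S: "1 + int j = int a + int b \<or> 1 + int j + (int a + int b) = int m + int n + 2"
      using fold[of "1 + int j" "-2" "int m + int n" "int a + int b"]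
        corner1[of 1 j] corner1[of a b] ab j eq \<open>1 < m\<close> by simp
    have T: "1 - int j = int a - int b \<or> 1 - int j + (int a - int b) = int m - int n"
      using fold[of "1 - int j" "int n - 1" "int m - 1" "int a - int b"]
        cornern[of 1 j] cornern[of a b] ab j eq \<open>1 < m\<close> by simp
    have "int j = min (int a + int b - 3) (int m + int n + 1 - (int a + int b))"
      using third_first_column[of 1 j] third[of a b] ab j eq \<open>1 < m\<close> False by simp
    \<comment> \<open>The minimum gives \<open>j \<le> a + b - 3\<close>, so only the reflected sum
      survives in \<open>S\<close>. Combined with the equal difference in \<open>T\<close> it yields
      \<open>2 * b = m + n\<close>, against parity; combined with the reflected difference it yields
      \<open>a = m\<close>, outside the range.\<close>
    then have "1 + int j \<noteq> int a + int b" by linarith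
    moreover have "2 * int b - 2 * t \<noteq> 1" by presburger
    ultimately have False using S T t ab(2) by linarith
    then show ?thesis ..
  qed
  obtain i j where u: "u = (i, j)" "1 \<le> i" "i < m" "1 \<le> j" "j \<le> n"
    using assms(4) by (rule mobius_vertexE)
  obtain a b where v: "v = (a, b)" "1 \<le> a" "a < m" "1 \<le> b" "b \<le> n"
    using assms(5) by (rule mobius_vertexE)
  consider "i = 1" | "a = 1" | "2 \<le> i" "2 \<le> a" using u v by linarith
  then show ?thesis
  proof cases
    case 1
    then show ?thesis using first_column[of a b j] u v assms by simp
  next
    case 2
    then show ?thesis using first_column[of i j b] u v assms by simp
  next
    case 3
    have S: "int i + int j = int a + int b \<or> int i + int j + (int a + int b) = int m + int n + 2"
      using fold[of "int i + int j" "-2" "int m + int n" "int a + int b"]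
        corner1[of i j] corner1[of a b] u v assms(6) by simp
    have "int i + int j = int a + int b \<or> int i + int j + (int a + int b) = 4 + (int m + int n)"
      using fold[of "int i + int j" "-3" "int m + int n + 1" "int a + int b"]
        third[of i j] third[of a b] u v assms(8) 3 by simp
    \<comment> \<open>The two reflections would require the sums to add up to both
      \<open>m + n + 2\<close> and \<open>m + n + 4\<close>.\<close>
    with S have "int i + int j = int a + int b" by linarith
    moreover have "int i - int j = int a - int b \<or> int i - int j + (int a - int b) = int m - int n"
      using fold[of "int i - int j" "int n - 1" "int m - 1" "int a - int b"]
        cornern[of i j] cornern[of a b] u v assms(7) by simp
    ultimately show ?thesis using same_sheet u v by simp
  qed
qed

section \<open>Equidistant neighbours of a vertex\<close>

lemma twisted_dist_adjacent:
  assumes "m \<ge> 3" "n < m" "(u, w) \<in> parcs (mobius_ladder m n)"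
  shows "twisted_dist m n u w = 1"
proof -
  interpret pair_graph "mobius_ladder m n" by (rule pair_graph_mobius_ladder) fact
  have uw: "u \<in> pverts (mobius_ladder m n)" "w \<in> pverts (mobius_ladder m n)"
    using assms(3) in_arcsD1 in_arcsD2 by blast+
  have "u \<noteq> w" using no_loops[OF assms(3)] by simp
  show ?thesis
    using twisted_dist_arc[OF assms(1-3) uw(2)] twisted_dist_descent[OF assms(1,2) uw \<open>u \<noteq> w\<close>]
    by (auto simp: twisted_dist_self)
qed

definition next_column :: "nat \<Rightarrow> nat \<Rightarrow> nat \<times> nat \<Rightarrow> nat \<times> nat" where
  "next_column m n w = (if fst w + 1 < m then (fst w + 1, snd w) else (1, n + 1 - snd w))"

definition prev_column :: "nat \<Rightarrow> nat \<Rightarrow> nat \<times> nat \<Rightarrow> nat \<times> nat" where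
  "prev_column m n w = (if 1 < fst w then (fst w - 1, snd w) else (m - 1, n + 1 - snd w))"

lemma next_column_arc:
  assumes "w \<in> pverts (mobius_ladder m n)"
  shows "(next_column m n w, w) \<in> parcs (mobius_ladder m n)"
proof -
  obtain i j where w: "w = (i, j)" "1 \<le> i" "i < m" "1 \<le> j" "j \<le> n"
    using assms by (rule mobius_vertexE)
  have "(w, next_column m n w) \<in> parcs (mobius_ladder m n)"
  proof (cases "i + 1 < m")
    case True
    then show ?thesis
      using w mobius_arc_horizontal[of i m j n] by (simp add: next_column_def)
  next
    case False
    then have "i = m - 1" using w(3) by simp
    then show ?thesis
      using w mobius_arc_twist[of j n m] by (simp add: next_column_def)
  qed
  then show ?thesis by (rule mobius_arc_sym)
qed

lemma prev_column_arc:
  assumes "w \<in> pverts (mobius_ladder m n)"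
  shows "(prev_column m n w, w) \<in> parcs (mobius_ladder m n)"
proof -
  obtain i j where w: "w = (i, j)" "1 \<le> i" "i < m" "1 \<le> j" "j \<le> n"
    using assms by (rule mobius_vertexE)
  show ?thesis
  proof (cases "1 < i")
    case True
    then show ?thesis
      using w mobius_arc_horizontal[of "i - 1" m j n] by (simp add: prev_column_def)
  next
    case False
    then show ?thesis
      using w mobius_arc_twist[of "n + 1 - j" n m] by (simp add: prev_column_def)
  qed
qed

lemma column_neighbours_distinct:
  assumes "m \<ge> 5" "w \<in> pverts (mobius_ladder m n)"
  shows "next_column m n w \<noteq> prev_column m n w"
    and "fst (next_column m n w) \<noteq> fst w" "fst (prev_column m n w) \<noteq> fst w"
  using assms by (auto simp: next_column_def prev_column_def)

text \<open>Stepping over the end of the strip swaps the direct and the through distance, so after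
  taking the minimum the last column needs no separate formula. Only the side on which
  \<open>a\<close> lies matters.\<close>

lemma twisted_dist_next_column:
  assumes "1 \<le> i" "i < m" "1 \<le> j" "j \<le> n" "1 \<le> a" "a < m"
  shows "twisted_dist m n (next_column m n (i, j)) (a, b) =
    (if a \<le> i
     then nat (min (int i + 1 - int a + \<bar>int j - int b\<bar>)
                   (int m - 2 - int i + int a + \<bar>int j + int b - int n - 1\<bar>))
     else nat (min (int a - int i - 1 + \<bar>int j - int b\<bar>)
                   (int m + int i - int a + \<bar>int j + int b - int n - 1\<bar>)))"
proof (cases "i + 1 < m")
  case True
  then show ?thesis
    using assms by (auto simp: next_column_def twisted_dist_def dist_pair algebra_simps)
next
  case False
  then have "m = i + 1" using assms(2) by simp
  moreover have "int (n + 1 - j) = int n + 1 - int j" using assms(4) by (simp add: of_nat_diff)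
  ultimately show ?thesis
    using assms(5,6) by (simp add: next_column_def twisted_dist_def dist_pair min.commute algebra_simps)
qed

lemma twisted_dist_prev_column:
  assumes "1 \<le> i" "i < m" "1 \<le> j" "j \<le> n" "1 \<le> a" "a < m"
  shows "twisted_dist m n (prev_column m n (i, j)) (a, b) =
    (if i \<le> a
     then nat (min (int a - int i + 1 + \<bar>int j - int b\<bar>)
                   (int m - 2 + int i - int a + \<bar>int j + int b - int n - 1\<bar>))
     else nat (min (int i - int a - 1 + \<bar>int j - int b\<bar>)
                   (int m - int i + int a + \<bar>int j + int b - int n - 1\<bar>)))"
proof (cases "1 < i")
  case True
  then show ?thesis
    using assms by (auto simp: prev_column_def twisted_dist_def dist_pair of_nat_diff algebra_simps)
next
  case False
  then have "i = 1" using assms(1) by simp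
  moreover have "int (n + 1 - j) = int n + 1 - int j" "int (m - 1) = int m - 1"
    using assms(2,4) by (simp_all add: of_nat_diff)
  ultimately show ?thesis
    using assms(5,6) by (simp add: prev_column_def twisted_dist_def dist_pair min.commute algebra_simps)
qed

lemma equidistant_neighbours_interior:
  assumes "m \<ge> 5" "n < m" "w \<in> pverts (mobius_ladder m n)" "v \<in> pverts (mobius_ladder m n)"
    and interior: "1 < snd w" "snd w < n"
  shows "\<exists>x y. x \<noteq> y \<and> (x, w) \<in> parcs (mobius_ladder m n) \<and> (y, w) \<in> parcs (mobius_ladder m n) \<and>
    twisted_dist m n x v = twisted_dist m n y v"
proof -
  obtain i j where w: "w = (i, j)" "1 \<le> i" "i < m" "1 \<le> j" "j \<le> n"
    using assms(3) by (rule mobius_vertexE)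
  let ?N = "{(i, j + 1), (i, j - 1), next_column m n w, prev_column m n w}"
  let ?d = "\<lambda>x. twisted_dist m n x v"
  have arcs: "(x, w) \<in> parcs (mobius_ladder m n)" if "x \<in> ?N" for x
    using that w interior next_column_arc[OF assms(3)] prev_column_arc[OF assms(3)]
      mobius_arc_sym[OF mobius_arc_vertical[of i m j n]] mobius_arc_vertical[of i m "j - 1" n]
    by auto
  \<comment> \<open>Four neighbours take at most three values. If \<open>?d w = 0\<close>, truncated
    subtraction only makes the interval smaller.\<close>
  have "?d ` ?N \<subseteq> {?d w - 1..?d w + 1}"
  proof (rule image_subsetI)
    fix x assume "x \<in> ?N"
    then have "(x, w) \<in> parcs (mobius_ladder m n)" by (rule arcs)
    then show "?d x \<in> {?d w - 1..?d w + 1}"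
      using twisted_dist_arc[of m n x w v] twisted_dist_arc[of m n w x v] mobius_arc_sym assms
      by fastforce
  qed
  then have "card (?d ` ?N) \<le> card {?d w - 1..?d w + 1}" by (intro card_mono) simp_all
  also have "\<dots> < 4" by simp
  also have "4 = card ?N"
  proof -
    have "(i, y) \<noteq> next_column m n w" "(i, y) \<noteq> prev_column m n w" for y
      using column_neighbours_distinct[OF assms(1,3)] w(1) by (metis fst_conv)+
    then show ?thesis
      using column_neighbours_distinct(1)[OF assms(1,3)] by (simp add: card_insert_if)
  qed
  finally have "\<not> inj_on ?d ?N" by (rule pigeonhole)
  then show ?thesis using arcs unfolding inj_on_def by blast
qed

text \<open>In the same row, the inward vertical step and the horizontal step away from column
  \<open>a\<close> both raise the direct distance and lower the through distance by one. In opposite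
  rows, the inward step matches the horizontal step towards column \<open>a\<close>; if the columns
  agree as well, the two horizontal neighbours are symmetric.\<close>

lemma equidistant_neighbours_boundary:
  assumes "n \<ge> 2" "m \<ge> 5" "w \<in> pverts (mobius_ladder m n)" "v \<in> pverts (mobius_ladder m n)" "w \<noteq> v"
    and boundary: "snd w = 1 \<or> snd w = n" "snd v = 1 \<or> snd v = n"
  shows "\<exists>x y. x \<noteq> y \<and> (x, w) \<in> parcs (mobius_ladder m n) \<and> (y, w) \<in> parcs (mobius_ladder m n) \<and>
    twisted_dist m n x v = twisted_dist m n y v"
proof -
  obtain i j where w: "w = (i, j)" "1 \<le> i" "i < m" "1 \<le> j" "j \<le> n"
    using assms(3) by (rule mobius_vertexE)
  obtain a b where v: "v = (a, b)" "1 \<le> a" "a < m" "1 \<le> b" "b \<le> n"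
    using assms(4) by (rule mobius_vertexE)
  \<comment> \<open>The row next to the boundary row of \<open>w\<close>, on the inside; for
    \<open>n = 2\<close> it is the opposite boundary.\<close>
  define j' where "j' = (if j = 1 then 2 else n - 1)"
  define x where "x = (i, j')"
  have j: "j = 1 \<or> j = n" and b: "b = 1 \<or> b = n" using boundary w v by simp_all
  have x_arc: "(x, w) \<in> parcs (mobius_ladder m n)"
    using j w assms(1) mobius_arc_sym[OF mobius_arc_vertical[of i m 1 n]] mobius_arc_vertical[of i m "n - 1" n]
    by (auto simp: x_def j'_def numeral_2_eq_2)
  note arcs = x_arc next_column_arc[OF assms(3)] prev_column_arc[OF assms(3)]
  note distinct = column_neighbours_distinct[OF assms(2,3)]
  have x_distinct: "x \<noteq> next_column m n w" "x \<noteq> prev_column m n w"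
    using distinct w by (metis fst_conv x_def)+
  have x_dist: "twisted_dist m n x v = nat (min (\<bar>int i - int a\<bar> + \<bar>int j' - int b\<bar>)
      (int m - 1 - \<bar>int i - int a\<bar> + \<bar>int j' + int b - int n - 1\<bar>))"
    unfolding x_def v(1) twisted_dist_def dist_pair ..
  note dist = x_dist twisted_dist_next_column[OF w(2-5) v(2,3), of b, folded w(1), folded v(1)]
    twisted_dist_prev_column[OF w(2-5) v(2,3), of b, folded w(1), folded v(1)]
  show ?thesis
  proof (cases "j = b")
    case True
    then have height: "\<bar>int j - int b\<bar> = 0" "\<bar>int j + int b - int n - 1\<bar> = int n - 1"
      "\<bar>int j' - int b\<bar> = 1" "\<bar>int j' + int b - int n - 1\<bar> = int n - 2"
      using j assms(1) by (auto simp: j'_def of_nat_diff)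
    have "i \<noteq> a" using True w v assms(5) by simp
    then consider "i < a" | "a < i" by linarith
    then show ?thesis
    proof cases
      case 1
      then have "twisted_dist m n x v = twisted_dist m n (prev_column m n w) v"
        unfolding dist height by (simp add: algebra_simps)
      then show ?thesis using arcs x_distinct by blast
    next
      case 2
      then have "twisted_dist m n x v = twisted_dist m n (next_column m n w) v"
        unfolding dist height by (simp add: algebra_simps)
      then show ?thesis using arcs x_distinct by blast
    qed
  next
    case False
    then have height: "\<bar>int j - int b\<bar> = int n - 1" "\<bar>int j + int b - int n - 1\<bar> = 0"
      "\<bar>int j' - int b\<bar> = int n - 2" "\<bar>int j' + int b - int n - 1\<bar> = 1"
      using j b assms(1) by (auto simp: j'_def of_nat_diff)
    consider "i = a" | "i < a" | "a < i" by linarith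
    then show ?thesis
    proof cases
      case 1
      then have "twisted_dist m n (next_column m n w) v = twisted_dist m n (prev_column m n w) v"
        unfolding dist height by (simp add: algebra_simps)
      then show ?thesis using arcs distinct(1) by blast
    next
      case 2
      then have "twisted_dist m n x v = twisted_dist m n (next_column m n w) v"
        unfolding dist height by (simp add: algebra_simps)
      then show ?thesis using arcs x_distinct by blast
    next
      case 3
      then have "twisted_dist m n x v = twisted_dist m n (prev_column m n w) v"
        unfolding dist height by (simp add: algebra_simps)
      then show ?thesis using arcs x_distinct by blast
    qed
  qed
qed

text \<open>Two neighbours of one vertex are both at distance one from it, so being equidistant from
  the other vertex makes them indistinguishable. The roles of \<open>w\<close> and \<open>v\<close>
  may be exchanged, which lets an interior vertex be chosen whenever there is one.\<close>

lemma pair_not_resolving: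
  assumes "n \<ge> 2" "m \<ge> 5" "n < m"
    and "w \<in> pverts (mobius_ladder m n)" "v \<in> pverts (mobius_ladder m n)" "w \<noteq> v"
  shows "\<exists>x\<in>pverts (mobius_ladder m n). \<exists>y\<in>pverts (mobius_ladder m n). x \<noteq> y \<and>
    twisted_dist m n x w = twisted_dist m n y w \<and> twisted_dist m n x v = twisted_dist m n y v"
proof -
  have m: "m \<ge> 3" using assms(2) by simp
  interpret pair_graph "mobius_ladder m n" by (rule pair_graph_mobius_ladder) fact
  define P where "P w v \<longleftrightarrow> (\<exists>x y. x \<noteq> y \<and> (x, w) \<in> parcs (mobius_ladder m n) \<and>
    (y, w) \<in> parcs (mobius_ladder m n) \<and> twisted_dist m n x v = twisted_dist m n y v)" for w v
  have range: "1 \<le> snd w \<and> snd w \<le> n" "1 \<le> snd v \<and> snd v \<le> n"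
    using assms(4,5) by auto
  then consider "1 < snd w" "snd w < n" | "1 < snd v" "snd v < n"
    | "snd w = 1 \<or> snd w = n" "snd v = 1 \<or> snd v = n" by linarith
  then have "P w v \<or> P v w"
  proof cases
    case 1
    then show ?thesis unfolding P_def using equidistant_neighbours_interior assms by blast
  next
    case 2
    then show ?thesis unfolding P_def using equidistant_neighbours_interior assms by blast
  next
    case 3
    then show ?thesis unfolding P_def using equidistant_neighbours_boundary assms by blast
  qed
  moreover have "x \<in> pverts (mobius_ladder m n) \<and> twisted_dist m n x w = 1"
    if "(x, w) \<in> parcs (mobius_ladder m n)" for x w
    using that twisted_dist_adjacent[OF m assms(3)] in_arcsD1 by blast
  ultimately show ?thesis unfolding P_def by metis
qed

section \<open>Upper and lower bound for the metric dimension\<close>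

theorem theorem3p1:
  fixes m n :: nat
  assumes "n \<ge> 2"
    and "m \<ge> n + 3"
    and "(even m \<and> odd n) \<or> (odd m \<and> even n)"
  shows "metric_dim (with_proj (mobius_ladder m n)) = 3"
  unfolding metric_dim_def
proof (rule Least_equality)
  let ?V = "pverts (mobius_ladder m n)"
  have m: "m \<ge> 3" "n < m" "m \<ge> 5" and parity: "odd (m + n)" using assms by auto
  note dist = graph_dist_mobius_ladder[OF m(1,2)]
  let ?ws = "[(1, 1), (1, n), (2, 1)] :: (nat \<times> nat) list"
  have "resolving_set (with_proj (mobius_ladder m n)) ?ws"
    unfolding resolving_set_def
  proof (intro conjI ballI impI)
    show "distinct ?ws" using assms by simp
    show "set ?ws \<subseteq> verts (with_proj (mobius_ladder m n))"
      using assms by auto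
    fix u v assume uv: "u \<in> verts (with_proj (mobius_ladder m n))"
      "v \<in> verts (with_proj (mobius_ladder m n))" "u \<noteq> v"
    have "(1, 1) \<in> ?V" "(1, n) \<in> ?V" "(2, 1) \<in> ?V" using assms by auto
    then show "representation (with_proj (mobius_ladder m n)) ?ws u \<noteq>
        representation (with_proj (mobius_ladder m n)) ?ws v"
      using uv twisted_dist_corners_inj[OF assms(1,2) parity, of u v] dist
      by (auto simp: representation_def simp del: pverts_mobius_ladder)
  qed
  then show "\<exists>ws. resolving_set (with_proj (mobius_ladder m n)) ws \<and> length ws = 3"
    by (intro exI[of _ ?ws]) simp
  have "3 \<le> length ws" if ws: "resolving_set (with_proj (mobius_ladder m n)) ws" for ws
  proof (rule ccontr)
    assume "\<not> 3 \<le> length ws"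
    then have "card (set ws) \<le> 2" using card_length[of ws] by linarith
    moreover have sub: "set ws \<subseteq> ?V" using ws by (simp add: resolving_set_def)
    moreover have "2 \<le> card ?V"
    proof -
      have "2 * 1 \<le> (m - 1) * n" using assms by (intro mult_le_mono) auto
      then show ?thesis by simp
    qed
    \<comment> \<open>A list of length zero or one is covered too: its set is enlarged to exactly
      two vertices, and a pair of vertices not separated by the larger set is not separated by the
      smaller one.\<close>
    ultimately obtain T where "set ws \<subseteq> T" "T \<subseteq> ?V" "card T = 2"
      using exists_subset_between[of "set ws" 2 ?V] by auto
    then obtain w v where wv: "w \<in> ?V" "v \<in> ?V" "w \<noteq> v" "set ws \<subseteq> {w, v}"
      by (auto simp: card_2_iff)
    then obtain x y where xy: "x \<in> ?V" "y \<in> ?V" "x \<noteq> y"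
      "twisted_dist m n x w = twisted_dist m n y w" "twisted_dist m n x v = twisted_dist m n y v"
      using pair_not_resolving[OF assms(1) m(3,2)] by blast
    have "graph_dist (with_proj (mobius_ladder m n)) x z = graph_dist (with_proj (mobius_ladder m n)) y z"
      if "z \<in> set ws" for z
    proof -
      have "z = w \<or> z = v" using that wv(4) by blast
      then show ?thesis using xy wv(1,2) by (metis dist)
    qed
    then have "representation (with_proj (mobius_ladder m n)) ws x =
        representation (with_proj (mobius_ladder m n)) ws y"
      by (simp add: representation_def)
    then show False using ws xy unfolding resolving_set_def with_proj_simps by blast
  qed
  then show "\<And>k. \<exists>ws. resolving_set (with_proj (mobius_ladder m n)) ws \<and> length ws = k \<Longrightarrow> 3 \<le> k"
    by blast
qed

end
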